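(* Let $\varphi_1,\varphi_2,\psi$ be analytic functions, let $\alpha,\beta\in\mathbb{R}^{+}\setminus\{1\}$, and let the family of analytic functions $\Theta_n$ be defined by the Rodrigues type formula $\Theta_n(x)=\alpha^{\varphi_1(x)}\frac{d^n}{dx^n}\left(\psi(x)\beta^{-\varphi_2(x)}\right)$, $n=0,1,2,\dots$. If $$\Lambda_{\mu,\nu}(y;z):=\sum_{k=0}^{\infty}a_k\,\Theta_{\mu+\nu k}(y)\,z^k,$$ where $a_k\neq0$, $\mu,\nu\in\mathbb{C}$, and $$\Phi_{n,p,\mu,\nu}(x;y;\zeta):=\sum_{k=0}^{[n/p]}a_k\,\Theta_{\mu+\nu k}(y)\,\frac{\Theta_{n-pk}(x)}{(n-pk)!}\,\zeta^k,$$ where $n\in\mathbb{N}_0$, $p\in\mathbb{N}$, then $$\sum_{n=0}^{\infty}\Phi_{n,p,\mu,\nu}\left(x;y;\frac{\eta}{t^p}\right)t^n=\alpha^{\varphi_1(x)}\,\psi(x+t)\,\beta^{-\varphi_2(x+t)}\,\Lambda_{\mu,\nu}(y;\eta),$$ provided that each member of this identity exists.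
   Context: $\mathbb{N}=\{1,2,\dots\}$, $\mathbb{N}_0=\mathbb{N}\cup\{0\}$, and $[n/p]$ denotes the integer part of $n/p$.
   Formalization: The functions are taken analytic on an open set containing y and the whole segment from x to x+t; if only x and x+t lie in the domain, the identity can fail (e.g. ψ = principal logarithm with the segment crossing the branch cut). *)

theory Defs
  imports "HOL-Complex_Analysis.Complex_Analysis"
begin

definition rodrigues ::
  "real \<Rightarrow> real \<Rightarrow> (complex \<Rightarrow> complex) \<Rightarrow> (complex \<Rightarrow> complex) \<Rightarrow> (complex \<Rightarrow> complex)
    \<Rightarrow> nat \<Rightarrow> complex \<Rightarrow> complex" where
  "rodrigues \<alpha> \<beta> \<phi>1 \<phi>2 \<psi> n x =
     of_real \<alpha> powr \<phi>1 x * (deriv ^^ n) (\<lambda>u. \<psi> u * of_real \<beta> powr (- \<phi>2 u)) x"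

text \<open>
  The Rodrigues formula determines the family only at indices in \<open>\<nat>\<^sub>0\<close>, whereas the series below
  use the index \<open>\<mu> + \<nu> k\<close> with complex \<open>\<mu>\<close>, \<open>\<nu>\<close>. The family \<open>\<Theta>\<close> is therefore indexed by
  complex numbers; natural indices enter through \<^const>\<open>of_nat\<close>.
\<close>

definition Lambda_term ::
  "(nat \<Rightarrow> complex) \<Rightarrow> (complex \<Rightarrow> complex \<Rightarrow> complex) \<Rightarrow> complex \<Rightarrow> complex
    \<Rightarrow> complex \<Rightarrow> complex \<Rightarrow> nat \<Rightarrow> complex" where
  "Lambda_term a \<Theta> \<mu> \<nu> y z k = a k * \<Theta> (\<mu> + \<nu> * of_nat k) y * z ^ k"

definition Lambda ::
  "(nat \<Rightarrow> complex) \<Rightarrow> (complex \<Rightarrow> complex \<Rightarrow> complex) \<Rightarrow> complex \<Rightarrow> complex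
    \<Rightarrow> complex \<Rightarrow> complex \<Rightarrow> complex" where
  "Lambda a \<Theta> \<mu> \<nu> y z = (\<Sum>k. Lambda_term a \<Theta> \<mu> \<nu> y z k)"

definition Phi ::
  "(nat \<Rightarrow> complex) \<Rightarrow> (complex \<Rightarrow> complex \<Rightarrow> complex) \<Rightarrow> nat \<Rightarrow> nat \<Rightarrow> complex \<Rightarrow> complex
    \<Rightarrow> complex \<Rightarrow> complex \<Rightarrow> complex \<Rightarrow> complex" where
  "Phi a \<Theta> n p \<mu> \<nu> x y \<zeta> =
     (\<Sum>k = 0..n div p. a k * \<Theta> (\<mu> + \<nu> * of_nat k) y
        * (\<Theta> (of_nat (n - p * k)) x / fact (n - p * k)) * \<zeta> ^ k)"

end

theory Submission
  imports Defs
begin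

text \<open>Put \<open>f u = \<psi> u * of_real \<beta> powr (- \<phi>2 u)\<close> and
  \<open>A = of_real \<alpha> powr \<phi>1 x\<close>. By the Rodrigues formula,
  \<open>\<Theta> (of_nat n) x / fact n\<close> is \<open>A\<close> times the n-th Taylor
  coefficient of \<open>f\<close> at \<open>x\<close>, so formally the sum over n of
  \<open>\<Theta> (of_nat n) x / fact n * t ^ n\<close> is \<open>A * f (x + t)\<close>. Cutting off
  at \<open>n div p\<close> makes \<open>Phi\<close> times \<open>t ^ n\<close> the n-th term of the
  Cauchy product of this series with the \<open>Lambda\<close> series, the k-th term of the latter
  being placed at index \<open>p * k\<close>.

  The difficulty is convergence: the Taylor series may diverge at \<open>x + t\<close>, and the two
  series assumed summable may converge only conditionally. A variable s is therefore inserted, so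
  that \<open>x + s * t\<close> moves from \<open>x\<close> to \<open>x + t\<close>. For small s
  everything converges absolutely and the product formula holds. The power series of the
  \<open>Lambda\<close> factor and of the product both live on the whole unit disc, and the Taylor
  factor is replaced by the holomorphic function \<open>A * f (x + s * t)\<close>; the identity
  theorem carries the formula along [0, 1) (\<open>Cauchy_product_analytic_continuation\<close>).
  \<open>Abel_limit\<close> then lets s tend to 1 from the left.\<close>

lemma Abel_limit:
  fixes f :: "nat \<Rightarrow> 'a :: {real_normed_field, banach}"
  assumes "summable f"
  shows "((\<lambda>s. \<Sum>n. f n * of_real s ^ n) \<longlongrightarrow> suminf f) (at_left (1::real))"
proof -
  define P where "P n = (\<Sum>k\<le>n. f k) - suminf f" for n
  have P0: "P \<longlonglongrightarrow> 0"
    unfolding P_def using summable_LIMSEQ'[OF assms] LIM_zero by blast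
  \<comment> \<open>Abel summation: the Cauchy product with the geometric series turns coefficients
    into partial sums, and multiplying by \<open>1 - s\<close> undoes the division. Both factors
    converge absolutely because \<open>s < 1\<close>.\<close>
  have main: "(\<lambda>n. of_real (1 - s) * (P n * of_real s ^ n)) sums ((\<Sum>n. f n * of_real s ^ n) - suminf f)"
    if s: "0 < s" "s < 1" for s :: real
  proof -
    have geo: "(\<lambda>n. of_real s ^ n :: 'a) sums (1 / (1 - of_real s))"
      using s by (intro geometric_sums) auto
    have "summable (\<lambda>n. norm (f n * of_real s ^ n))"
      using assms s by (intro powser_insidea[of f 1]) auto
    moreover have "summable (\<lambda>n. norm (of_real s ^ n :: 'a))"
      using s by (auto simp: norm_power intro!: summable_geometric)
    ultimately have "(\<lambda>n. \<Sum>i\<le>n. (f i * of_real s ^ i) * of_real s ^ (n - i)) sums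
        ((\<Sum>n. f n * of_real s ^ n) * (\<Sum>n. of_real s ^ n))"
      by (rule Cauchy_product_sums)
    moreover have "(\<Sum>i\<le>n. (f i * of_real s ^ i) * of_real s ^ (n - i)) = (\<Sum>i\<le>n. f i) * of_real s ^ n" for n
      unfolding sum_distrib_right
      by (intro sum.cong refl) (simp add: mult.assoc flip: power_add)
    ultimately have "(\<lambda>n. (\<Sum>i\<le>n. f i) * of_real s ^ n) sums
        ((\<Sum>n. f n * of_real s ^ n) * (1 / (1 - of_real s)))"
      using sums_unique[OF geo] by simp
    from sums_diff[OF this sums_mult[OF geo, of "suminf f"]]
    have "(\<lambda>n. P n * of_real s ^ n) sums
        (((\<Sum>n. f n * of_real s ^ n) - suminf f) * (1 / (1 - of_real s)))"
      by (simp add: P_def algebra_simps)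
    from sums_mult[OF this, of "of_real (1 - s)"] show ?thesis
      using s by simp
  qed
  have "((\<lambda>s. (\<Sum>n. f n * of_real s ^ n) - suminf f) \<longlongrightarrow> 0) (at_left (1::real))"
  proof (rule tendstoI)
    fix e :: real assume "e > 0"
    then have "eventually (\<lambda>n. norm (P n) < e / 2) sequentially"
      using tendstoD[OF P0, of "e / 2"] by simp
    then obtain N where N: "norm (P n) < e / 2" if "n \<ge> N" for n
      unfolding eventually_sequentially by blast
    define C where "C = (\<Sum>n<N. norm (P n))"
    have "((\<lambda>s. (1 - s) * C + e / 2) \<longlongrightarrow> (1 - 1) * C + e / 2) (at_left (1::real))"
      by (intro tendsto_intros)
    from order_tendstoD(2)[OF this, of e]
    have "eventually (\<lambda>s. (1 - s) * C + e / 2 < e) (at_left (1::real))"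
      using \<open>e > 0\<close> by simp
    moreover have "eventually (\<lambda>s. s \<in> {0<..<1}) (at_left (1::real))"
      by (rule eventually_at_leftI[of 0]) auto
    ultimately show "eventually (\<lambda>s. dist ((\<Sum>n. f n * of_real s ^ n) - suminf f) 0 < e) (at_left 1)"
    proof eventually_elim
      case (elim s)
      then have s: "0 < s" "s < 1" by auto
      \<comment> \<open>A summable majorant: below \<open>N\<close> use
        \<open>s ^ n \<le> 1\<close>; from \<open>N\<close> on use
        \<open>norm (P n) < e / 2\<close>, where the factor \<open>1 - s\<close> normalises the
        geometric series to total \<open>e / 2\<close>. The finite part \<open>(1 - s) * C\<close>
        vanishes as s tends to 1.\<close>
      define h where "h n = (if n < N then (1 - s) * norm (P n) else 0) + (1 - s) * (e / 2) * s ^ n" for n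
      have "(\<lambda>n. if n \<in> {..<N} then (1 - s) * norm (P n) else 0) sums (\<Sum>n<N. (1 - s) * norm (P n))"
        by (rule sums_If_finite_set) auto
      moreover have "(\<lambda>n. (1 - s) * (e / 2) * s ^ n) sums ((1 - s) * (e / 2) * (1 / (1 - s)))"
        using s by (intro sums_mult geometric_sums) auto
      ultimately have "h sums ((\<Sum>n<N. (1 - s) * norm (P n)) + (1 - s) * (e / 2) * (1 / (1 - s)))"
        unfolding h_def lessThan_iff by (rule sums_add)
      moreover have "(1 - s) * (e / 2) * (1 / (1 - s)) = e / 2"
        using s by (simp add: field_simps)
      ultimately have h: "h sums ((1 - s) * C + e / 2)"
        by (simp only: C_def sum_distrib_left)
      have le: "norm (of_real (1 - s) * (P n * of_real s ^ n)) \<le> h n" for n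
      proof -
        have eq: "norm (of_real (1 - s) * (P n * of_real s ^ n)) = (1 - s) * (norm (P n) * s ^ n)"
          using s by (simp add: norm_mult norm_power del: of_real_diff)
        show ?thesis
        proof (cases "n < N")
          case True
          have "norm (P n) * s ^ n \<le> norm (P n) * 1"
            using s by (intro mult_left_mono power_le_one) auto
          then have "(1 - s) * (norm (P n) * s ^ n) \<le> (1 - s) * norm (P n)"
            using s by (intro mult_left_mono) auto
          moreover have "0 \<le> (1 - s) * (e / 2) * s ^ n"
            using s \<open>e > 0\<close> by simp
          ultimately show ?thesis
            using True unfolding eq h_def by simp
        next
          case False
          then have "(1 - s) * (norm (P n) * s ^ n) \<le> (1 - s) * (e / 2 * s ^ n)"
            using s N[of n] by (intro mult_left_mono mult_right_mono) auto
          then show ?thesis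
            using False unfolding eq h_def by (simp add: mult.assoc)
        qed
      qed
      have "norm ((\<Sum>n. f n * of_real s ^ n) - suminf f) \<le> (1 - s) * C + e / 2"
        using norm_suminf_le[OF le sums_summable[OF h]]
        unfolding sums_unique[OF main[OF s], symmetric] sums_unique[OF h, symmetric] .
      then show ?case
        using elim by simp
    qed
  qed
  then show ?thesis
    by (rule LIM_zero_cancel)
qed

text \<open>
  The power series of \<open>g\<close> at \<open>0\<close> need not converge at \<open>1\<close>, so Cauchy's and Abel's product theorems
  do not apply: the product formula is continued analytically along \<open>[0, 1)\<close> first.
\<close>
lemma Cauchy_product_analytic_continuation:
  fixes b c :: "nat \<Rightarrow> complex" and g :: "complex \<Rightarrow> complex"
  assumes U: "open U" "g holomorphic_on U" "closed_segment 0 1 \<subseteq> U"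
    and c: "eventually (\<lambda>s. (\<lambda>n. c n * s ^ n) sums g s) (nhds 0)"
    and b: "summable b"
    and d: "summable (\<lambda>n. \<Sum>i\<le>n. b i * c (n - i))"
  shows "(\<Sum>n. \<Sum>i\<le>n. b i * c (n - i)) = suminf b * g 1"
proof -
  define d where "d n = (\<Sum>i\<le>n. b i * c (n - i))" for n
  define B where "B s = (\<Sum>n. b n * s ^ n)" for s
  define D where "D s = (\<Sum>n. d n * s ^ n)" for s
  have hol: "(\<lambda>s. \<Sum>n. q n * s ^ n) holomorphic_on ball 0 1"
    if "summable q" for q :: "nat \<Rightarrow> complex"
  proof (rule power_series_holomorphic[where a = q and z = 0])
    fix w :: complex assume "w \<in> ball 0 1"
    then show "(\<lambda>n. q n * (w - 0) ^ n) sums (\<Sum>n. q n * w ^ n)"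
      using powser_inside[of q 1 w] that by (simp add: summable_sums)
  qed
  have holB: "B holomorphic_on ball 0 1" and holD: "D holomorphic_on ball 0 1"
    unfolding B_def D_def using hol b d by (auto simp: d_def)
  from c obtain r0 where "r0 > 0" and r0: "\<And>s. dist s 0 < r0 \<Longrightarrow> (\<lambda>n. c n * s ^ n) sums g s"
    unfolding eventually_nhds_metric by blast
  define V where "V = U \<inter> ball 0 1"
  \<comment> \<open>\<open>V\<close> may be disconnected, while the identity theorem needs a
    connected domain; the component of 0 suffices because it contains [0, 1).\<close>
  define T where "T = connected_component_set V 0"
  have "open V" using U by (simp add: V_def open_Int)
  have "0 \<in> U" using U by auto
  then have "0 \<in> V" by (simp add: V_def)
  have T: "open T" "connected T" "T \<subseteq> V" "0 \<in> T"
    using \<open>open V\<close> \<open>0 \<in> V\<close>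
    by (auto simp: T_def open_connected_component connected_component_subset)
  define W where "W = T \<inter> ball 0 r0"
  have DBg: "D s = B s * g s" if "s \<in> W" for s
  proof -
    have s: "norm s < 1" "norm s < r0"
      using that T by (auto simp: W_def V_def)
    \<comment> \<open>Convergence at the larger radius \<open>r\<close> makes the series of
      \<open>c\<close> absolutely convergent at \<open>s\<close>, as the Cauchy product
      requires.\<close>
    then obtain r where r: "norm s < r" "r < r0"
      using dense by blast
    then have "r > 0"
      using norm_ge_zero le_less_trans by blast
    have "summable (\<lambda>n. norm (b n * s ^ n))"
      using b s by (intro powser_insidea[of b 1]) auto
    moreover have "summable (\<lambda>n. norm (c n * s ^ n))"
      using r \<open>r > 0\<close> by (intro powser_insidea[of c "of_real r"] sums_summable[OF r0]) auto
    ultimately have "(\<lambda>n. \<Sum>i\<le>n. (b i * s ^ i) * (c (n - i) * s ^ (n - i))) sums (B s * (\<Sum>n. c n * s ^ n))"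
      unfolding B_def by (rule Cauchy_product_sums)
    moreover have "(\<Sum>i\<le>n. (b i * s ^ i) * (c (n - i) * s ^ (n - i))) = d n * s ^ n" for n
    proof -
      have "(b i * s ^ i) * (c (n - i) * s ^ (n - i)) = b i * c (n - i) * s ^ n" if "i \<le> n" for i
        using that by (simp add: power_diff_conv_inverse mult_ac flip: power_add)
      then show ?thesis
        unfolding d_def sum_distrib_right by (intro sum.cong) auto
    qed
    moreover have "(\<Sum>n. c n * s ^ n) = g s"
      using r0[of s] s by (simp add: sums_iff)
    ultimately show ?thesis
      by (simp add: D_def sums_iff)
  qed
  have DBgT: "D s = B s * g s" if "s \<in> T" for s
  proof (rule analytic_continuation_open[of W T D "\<lambda>s. B s * g s"])
    show "D holomorphic_on T" "(\<lambda>s. B s * g s) holomorphic_on T"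
      using holB holD U T unfolding V_def
      by (auto intro!: holomorphic_intros elim: holomorphic_on_subset)
    show "W \<noteq> {}"
      using \<open>r0 > 0\<close> T by (auto simp: W_def)
    show "open W" "W \<subseteq> T"
      using T by (auto simp: W_def)
  qed (fact T DBg that)+
  \<comment> \<open>The segment from 0 to s is connected and lies both in \<open>U\<close> and in
    the unit disc, hence in the component of 0.\<close>
  have real_T: "of_real s \<in> T" if "0 \<le> s" "s < 1" for s
  proof -
    have "closed_segment 0 (of_real s :: complex) \<subseteq> closed_segment 0 1"
      using that by (intro closed_segment_subset) (auto simp: in_segment scaleR_conv_of_real)
    moreover have "closed_segment 0 (of_real s :: complex) \<subseteq> ball 0 1"
      using that by (intro closed_segment_subset) auto
    ultimately have "closed_segment 0 (of_real s :: complex) \<subseteq> T"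
      unfolding T_def using U
      by (intro connected_component_maximal) (auto simp: V_def)
    then show ?thesis by auto
  qed
  have "1 \<in> U" using U by auto
  then have "isCont g 1"
    using U holomorphic_on_imp_continuous_on continuous_on_eq_continuous_at by blast
  then have g1: "((\<lambda>s. g (of_real s)) \<longlongrightarrow> g 1) (at_left (1::real))"
    by (rule isCont_tendsto_compose) (auto intro!: tendsto_eq_intros)
  \<comment> \<open>Only \<open>B\<close> and \<open>D\<close> need Abel's theorem at the boundary
    point 1; \<open>g\<close> is continuous there, whether or not its power series
    converges.\<close>
  have "((\<lambda>s. B (of_real s) * g (of_real s)) \<longlongrightarrow> suminf b * g 1) (at_left (1::real))"
    using tendsto_mult[OF Abel_limit[OF b] g1] by (simp add: B_def)
  moreover have "eventually (\<lambda>s. B (of_real s) * g (of_real s) = D (of_real s)) (at_left (1::real))"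
    by (rule eventually_at_leftI[of 0]) (simp_all add: DBgT real_T)
  ultimately have "((\<lambda>s. D (of_real s)) \<longlongrightarrow> suminf b * g 1) (at_left (1::real))"
    by (rule Lim_transform_eventually)
  moreover have "((\<lambda>s. D (of_real s)) \<longlongrightarrow> suminf d) (at_left (1::real))"
    using Abel_limit[of d] d by (simp add: D_def flip: d_def)
  ultimately have "suminf d = suminf b * g 1"
    by (intro tendsto_unique[OF trivial_limit_at_left_real])
  then show ?thesis
    by (simp add: d_def[abs_def])
qed

theorem corollary4:
  fixes \<phi>1 \<phi>2 \<psi> :: "complex \<Rightarrow> complex"
    and \<alpha> \<beta> :: real
    and \<Theta> :: "complex \<Rightarrow> complex \<Rightarrow> complex"
    and a :: "nat \<Rightarrow> complex"
    and \<mu> \<nu> x y t \<eta> :: complex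
    and p :: nat
    and S :: "complex set"
  assumes "open S"
    and "\<phi>1 analytic_on S" and "\<phi>2 analytic_on S" and "\<psi> analytic_on S"
    and "\<alpha> > 0" and "\<alpha> \<noteq> 1" and "\<beta> > 0" and "\<beta> \<noteq> 1"
    and "\<And>n u. u \<in> S \<Longrightarrow> \<Theta> (of_nat n) u = rodrigues \<alpha> \<beta> \<phi>1 \<phi>2 \<psi> n u"
    and "\<And>k. a k \<noteq> 0"
    and "p \<ge> 1"
    and "y \<in> S" and "closed_segment x (x + t) \<subseteq> S" and "t \<noteq> 0"
    and "summable (Lambda_term a \<Theta> \<mu> \<nu> y \<eta>)"
    and "summable (\<lambda>n. Phi a \<Theta> n p \<mu> \<nu> x y (\<eta> / t ^ p) * t ^ n)"
  shows "(\<Sum>n. Phi a \<Theta> n p \<mu> \<nu> x y (\<eta> / t ^ p) * t ^ n)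
       = of_real \<alpha> powr \<phi>1 x * \<psi> (x + t) * of_real \<beta> powr (- \<phi>2 (x + t)) * Lambda a \<Theta> \<mu> \<nu> y \<eta>"
proof -
  define f where "f u = \<psi> u * of_real \<beta> powr (- \<phi>2 u)" for u
  define A where "A = of_real \<alpha> powr \<phi>1 x"
  \<comment> \<open>The prefactor \<open>A\<close> stays at \<open>x\<close> while the argument of
    \<open>f\<close> moves, so \<open>g 1\<close> is exactly the factor in the claim, and
    \<open>c\<close> collects the Taylor coefficients of \<open>g\<close> at 0.\<close>
  define g where "g s = A * f (x + s * t)" for s
  define U where "U = (\<lambda>s. x + s * t) -` S"
  define c where "c n = \<Theta> (of_nat n) x / fact n * t ^ n" for n
  define L where "L = Lambda_term a \<Theta> \<mu> \<nu> y \<eta>"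
  \<comment> \<open>Spacing the \<open>Lambda\<close> terms out by \<open>p\<close>, with zeros
    between, turns the truncated sum in \<open>Phi\<close> into an ordinary convolution.\<close>
  define b where "b n = (if p dvd n then L (n div p) else 0)" for n
  note S = assms(1)
  have "f analytic_on S"
    unfolding f_def using assms(3,4,7) by (intro analytic_intros) auto
  then have hol_f: "f holomorphic_on S"
    by (rule analytic_imp_holomorphic)
  have "open U"
    unfolding U_def using S by (intro open_vimage continuous_intros)
  moreover have "g holomorphic_on U"
    unfolding g_def U_def
    by (intro holomorphic_intros holomorphic_on_compose_gen[OF _ hol_f, unfolded o_def]) auto
  moreover have "closed_segment 0 1 \<subseteq> U"
  proof
    fix s :: complex assume "s \<in> closed_segment 0 1"
    then obtain q where q: "0 \<le> q" "q \<le> 1" "s = of_real q"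
      by (auto simp: in_segment scaleR_conv_of_real)
    then have "x + s * t \<in> closed_segment x (x + t)"
      by (auto simp: in_segment scaleR_conv_of_real algebra_simps)
    then show "s \<in> U"
      using assms(13) by (auto simp: U_def)
  qed
  \<comment> \<open>The Taylor expansion of \<open>f\<close> is needed only while
    \<open>x + s * t\<close> stays in a ball around \<open>x\<close> inside
    \<open>S\<close>.\<close>
  moreover have "eventually (\<lambda>s. (\<lambda>n. c n * s ^ n) sums g s) (nhds 0)"
  proof -
    have "x \<in> S" using assms(13) by auto
    then obtain r where r: "r > 0" "ball x r \<subseteq> S"
      using S open_contains_ball by blast
    have "((\<lambda>s. x + s * t) \<longlongrightarrow> x) (nhds 0)"
      by (auto intro!: tendsto_eq_intros filterlim_ident)
    then have "eventually (\<lambda>s. x + s * t \<in> ball x r) (nhds 0)"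
      using r(1) by (intro topological_tendstoD) auto
    then show ?thesis
    proof eventually_elim
      case (elim s)
      have "(\<lambda>n. (deriv ^^ n) f x / fact n * (x + s * t - x) ^ n) sums f (x + s * t)"
        using elim r hol_f by (intro holomorphic_power_series) (auto elim: holomorphic_on_subset)
      from sums_mult[OF this, of A] show ?case
        using \<open>x \<in> S\<close> assms(9)
        by (simp add: c_def g_def A_def rodrigues_def f_def[abs_def] power_mult_distrib mult_ac)
    qed
  qed
  moreover have b: "b sums Lambda a \<Theta> \<mu> \<nu> y \<eta>"
  proof -
    have "strict_mono (\<lambda>k. p * k)"
      using assms(11) by (auto simp: strict_mono_def)
    moreover have "b n = 0" if "n \<notin> range (\<lambda>k. p * k)" for n
      using that by (auto simp: b_def dvd_def)
    ultimately have "(\<lambda>k. b (p * k)) sums Lambda a \<Theta> \<mu> \<nu> y \<eta> \<longleftrightarrow> b sums Lambda a \<Theta> \<mu> \<nu> y \<eta>"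
      by (rule sums_mono_reindex)
    moreover have "(\<lambda>k. b (p * k)) = L"
      using assms(11) by (auto simp: b_def)
    ultimately show ?thesis
      using assms(15) by (simp add: L_def Lambda_def[abs_def] summable_sums)
  qed
  \<comment> \<open>Only the indices \<open>i = p * k\<close> with \<open>k \<le> n div p\<close>
    contribute. There \<open>t ^ n\<close> splits as \<open>t ^ (n - p * k) * (t ^ p) ^ k\<close>,
    and since \<open>t \<noteq> 0\<close> the second factor cancels the denominator of
    \<open>(\<eta> / t ^ p) ^ k\<close>.\<close>
  moreover have Phi: "Phi a \<Theta> n p \<mu> \<nu> x y (\<eta> / t ^ p) * t ^ n = (\<Sum>i\<le>n. b i * c (n - i))" for n
  proof -
    have "(\<Sum>i\<le>n. b i * c (n - i)) = (\<Sum>i\<in>(\<lambda>k. p * k) ` {0..n div p}. b i * c (n - i))"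
    proof (rule sum.mono_neutral_right)
      show "(\<lambda>k. p * k) ` {0..n div p} \<subseteq> {..n}"
        using assms(11) by (auto simp: less_eq_div_iff_mult_less_eq mult.commute)
      show "\<forall>i\<in>{..n} - (\<lambda>k. p * k) ` {0..n div p}. b i * c (n - i) = 0"
      proof
        fix i assume i: "i \<in> {..n} - (\<lambda>k. p * k) ` {0..n div p}"
        have "\<not> p dvd i"
        proof
          assume "p dvd i"
          then have "i = p * (i div p)" by simp
          moreover have "i div p \<in> {0..n div p}"
            using i by (simp add: div_le_mono)
          ultimately show False
            using i by blast
        qed
        then show "b i * c (n - i) = 0"
          by (simp add: b_def)
      qed
    qed auto
    also have "\<dots> = (\<Sum>k = 0..n div p. b (p * k) * c (n - p * k))"
      using assms(11) by (subst sum.reindex) (auto simp: inj_on_def)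
    also have "\<dots> = Phi a \<Theta> n p \<mu> \<nu> x y (\<eta> / t ^ p) * t ^ n"
      unfolding Phi_def sum_distrib_right
    proof (rule sum.cong)
      fix k assume "k \<in> {0..n div p}"
      then have "p * k \<le> n"
        using assms(11) by (auto simp: less_eq_div_iff_mult_less_eq mult.commute)
      then have "t ^ n = t ^ (n - p * k) * (t ^ p) ^ k"
        by (simp flip: power_mult power_add)
      then show "b (p * k) * c (n - p * k) = a k * \<Theta> (\<mu> + \<nu> * of_nat k) y *
          (\<Theta> (of_nat (n - p * k)) x / fact (n - p * k)) * (\<eta> / t ^ p) ^ k * t ^ n"
        using assms(11,14) by (simp add: b_def c_def L_def Lambda_term_def power_divide)
    qed auto
    finally show ?thesis ..
  qed
  ultimately have "(\<Sum>n. \<Sum>i\<le>n. b i * c (n - i)) = suminf b * g 1"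
    using assms(16) by (intro Cauchy_product_analytic_continuation[of U]) (auto simp: sums_iff)
  then show ?thesis
    unfolding Phi using sums_unique[OF b] by (simp add: g_def A_def f_def)
qed

end
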